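(* Let $d$ be a positive integer, $s\ge3$ an integer, $c>0$ a real number, and $\beta$ a real number with $1<\beta<1+\frac{1}{s-1}$. Let $(G_k)_{k\in\mathbb{N}}$, $G_k=(L_k\sqcup R_k,E_k)$, be a family of $2$-optimal small-set expanders which are left-regular of degree $d$ and right-regular of degree $\delta=\delta_k$ (every vertex of $R_k$ has exactly $\delta_k$ incident edges), such that with $n_k=|L_k|$, $m_k=|R_k|$ we have $m_k\to\infty$ and $n_k$ is of the same order as $m_k^2$ (there are constants $0<c_1\le c_2$ with $c_1m_k^2\le n_k\le c_2m_k^2$ for all large $k$). For each $k$, let $X_k\subseteq L_k$ be a uniformly chosen random subset of size $\lfloor c\,m_k^{\beta}\rfloor<n_k$, let $H_k$ be the induced bipartite subgraph with vertices $X_k\sqcup N(X_k)$, and let $T_k$ be the subgraph resulting from $H_k$ by successively removing all the left vertices of some cycle of length $\le 2s$ until no cycle of length $\le 2s$ remains. Then the minimum right-degree $d_{T_k}^*$ of $T_k$ satisfies $$\lim_{k\to\infty}\Pr\left(d_{T_k}^*<\frac12\, d\cdot c\, m_k^{\beta-1}\right)=0 .$$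
   Context: Graphs are finite and simple. A bipartite graph $G$ with parts $L\sqcup R$ is left-regular of degree $d$ if every vertex of $L$ has exactly $d$ incident edges. For $X\subseteq L$, $N(X)\subseteq R$ is the set of vertices adjacent to at least one vertex of $X$. For an integer $1\le t\le |L|$, $\alpha_G(t):=\min\{|N(X)|/|X|: X\subseteq L,\ 0<|X|\le t\}$. A left-regular bipartite graph $G$ of degree $d$ is an $s$-optimal small-set expander if $\alpha_G(t)\ge (d-1)+\frac1t$ for every integer $1\le t\le s$. The length of a cycle is its number of vertices. The removal procedure deletes only left vertices (with their incident edges), so the right vertices of $T_k$ are those of $H_k$; at each step the cycle removed is taken to be a shortest cycle of the current graph, ties being broken arbitrarily. The minimum right-degree of $T_k$ is the minimum, over its right vertices, of the degree in $T_k$. *)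

theory Defs
  imports "HOL-Probability.Probability"
begin

record 'v bigraph =
  lverts :: "'v set"
  rverts :: "'v set"
  edges :: "'v set set"

definition bipartite_graph :: "'v bigraph \<Rightarrow> bool" where
  "bipartite_graph G \<longleftrightarrow>
     finite (lverts G) \<and> finite (rverts G) \<and> lverts G \<inter> rverts G = {} \<and>
     edges G \<subseteq> {{u, v} | u v. u \<in> lverts G \<and> v \<in> rverts G}"

definition vdegree :: "'v bigraph \<Rightarrow> 'v \<Rightarrow> nat" where
  "vdegree G v = card {e \<in> edges G. v \<in> e}"

definition left_regular :: "'v bigraph \<Rightarrow> nat \<Rightarrow> bool" where
  "left_regular G d \<longleftrightarrow> (\<forall>u \<in> lverts G. vdegree G u = d)"

definition right_regular :: "'v bigraph \<Rightarrow> nat \<Rightarrow> bool" where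
  "right_regular G d \<longleftrightarrow> (\<forall>v \<in> rverts G. vdegree G v = d)"

definition nbhd :: "'v bigraph \<Rightarrow> 'v set \<Rightarrow> 'v set" where
  "nbhd G X = {v \<in> rverts G. \<exists>u \<in> X. {u, v} \<in> edges G}"

definition expansion :: "'v bigraph \<Rightarrow> nat \<Rightarrow> real" where
  "expansion G t =
     Min ((\<lambda>X. real (card (nbhd G X)) / real (card X)) `
            {X. X \<subseteq> lverts G \<and> 0 < card X \<and> card X \<le> t})"

definition optimal_expander :: "nat \<Rightarrow> nat \<Rightarrow> 'v bigraph \<Rightarrow> bool" where
  "optimal_expander d s G \<longleftrightarrow>
     bipartite_graph G \<and> left_regular G d \<and>
     (\<forall>t. 1 \<le> t \<and> t \<le> s \<longrightarrow> expansion G t \<ge> (real d - 1) + 1 / real t)"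

definition induced :: "'v bigraph \<Rightarrow> 'v set \<Rightarrow> 'v bigraph" where
  "induced G X =
     \<lparr>lverts = X, rverts = nbhd G X, edges = {e \<in> edges G. e \<subseteq> X \<union> nbhd G X}\<rparr>"

text \<open>A cycle is given by the list of its vertices, in cyclic order; its length is the
  length of the list.\<close>

definition is_cycle :: "'v bigraph \<Rightarrow> 'v list \<Rightarrow> bool" where
  "is_cycle G vs \<longleftrightarrow>
     distinct vs \<and> 3 \<le> length vs \<and>
     (\<forall>i < length vs. {vs ! i, vs ! (Suc i mod length vs)} \<in> edges G)"

definition delete_left :: "'v bigraph \<Rightarrow> 'v set \<Rightarrow> 'v bigraph" where
  "delete_left G S =
     \<lparr>lverts = lverts G - S, rverts = rverts G, edges = {e \<in> edges G. e \<inter> S = {}}\<rparr>"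

definition removal_step :: "nat \<Rightarrow> 'v bigraph \<Rightarrow> 'v bigraph \<Rightarrow> bool" where
  "removal_step s G G' \<longleftrightarrow>
     (\<exists>vs. is_cycle G vs \<and> length vs \<le> 2 * s \<and>
           (\<forall>ws. is_cycle G ws \<longrightarrow> length vs \<le> length ws) \<and>
           G' = delete_left G (set vs \<inter> lverts G))"

text \<open>A relation rather than a function, because ties between shortest cycles are broken
  arbitrarily.\<close>

definition removal_result :: "nat \<Rightarrow> 'v bigraph \<Rightarrow> 'v bigraph \<Rightarrow> bool" where
  "removal_result s H T \<longleftrightarrow>
     (removal_step s)\<^sup>*\<^sup>* H T \<and> \<not> (\<exists>vs. is_cycle T vs \<and> length vs \<le> 2 * s)"

definition min_right_degree :: "'v bigraph \<Rightarrow> nat" where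
  "min_right_degree G = Min (vdegree G ` rverts G)"

definition left_subsets :: "'v bigraph \<Rightarrow> nat \<Rightarrow> 'v set set" where
  "left_subsets G q = {X. X \<subseteq> lverts G \<and> card X = q}"

end

theory Submission
  imports Defs "HOL-Real_Asymp.Real_Asymp"
begin

text \<open>
  Write \<open>p = q / n\<close> and \<open>M = d c m\<^sup>\<beta>\<^sup>-\<^sup>1\<close>. The degree of a right vertex \<open>v\<close> in \<open>H\<close> is
  hypergeometric with mean close to \<open>M\<close>, so it falls below \<open>2M/3\<close> only with probability
  exponentially small in \<open>M\<close>. The removal procedure deletes pairwise disjoint sets of at most \<open>s\<close>
  left vertices, so \<open>v\<close> can lose more than \<open>M/6\<close> neighbours only if the random set contains
  \<open>M/(6s)\<close> pairwise disjoint cycles that meet the neighbourhood of \<open>v\<close>. Two left vertices of a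
  2-optimal expander have at most one common neighbour, so a cycle is determined by its right
  vertices and one left vertex; hence the expected number \<open>\<mu>\<close> of cycles of length at most \<open>2s\<close>
  that meet the neighbourhood of \<open>v\<close> is \<open>O(m\<^sup>s\<^sup>(\<^sup>\<beta>\<^sup>-\<^sup>1\<^sup>)\<^sup>-\<^sup>1)\<close>, which is \<open>o(M)\<close> because
  \<open>(s - 1)(\<beta> - 1) < 1\<close>. Disjoint sets are contained in the random set with at most the product of
  the probabilities, so an exponential moment of the number of disjoint cycles yields a tail that is
  again exponentially small in \<open>M\<close>. A union bound over the \<open>m\<close> right vertices finishes the proof.
\<close>

section \<open>Uniformly random subsets of fixed size\<close>

lemma card_superset_subsets:
  assumes "finite L" "B \<subseteq> L" "card B \<le> q"
  shows "card {X. X \<subseteq> L \<and> card X = q \<and> B \<subseteq> X} = (card L - card B) choose (q - card B)"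
proof -
  have fB: "finite B" using assms finite_subset by blast
  have "bij_betw (\<lambda>Y. Y \<union> B) {Y. Y \<subseteq> L - B \<and> card Y = q - card B}
          {X. X \<subseteq> L \<and> card X = q \<and> B \<subseteq> X}"
  proof (rule bij_betw_byWitness[where f' = "\<lambda>X. X - B"])
    show "(\<lambda>Y. Y \<union> B) ` {Y. Y \<subseteq> L - B \<and> card Y = q - card B}
        \<subseteq> {X. X \<subseteq> L \<and> card X = q \<and> B \<subseteq> X}"
    proof clarify
      fix Y assume Y: "Y \<subseteq> L - B" "card Y = q - card B"
      have "finite Y" using Y assms(1) finite_subset by blast
      then have "card (Y \<union> B) = q"
        using Y fB assms(3) by (subst card_Un_disjoint) auto
      then show "Y \<union> B \<subseteq> L \<and> card (Y \<union> B) = q \<and> B \<subseteq> Y \<union> B"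
        using Y assms(2) by auto
    qed
    show "(\<lambda>X. X - B) ` {X. X \<subseteq> L \<and> card X = q \<and> B \<subseteq> X}
        \<subseteq> {Y. Y \<subseteq> L - B \<and> card Y = q - card B}"
      using fB by (auto simp: card_Diff_subset)
  qed auto
  then have "card {X. X \<subseteq> L \<and> card X = q \<and> B \<subseteq> X}
      = card {Y. Y \<subseteq> L - B \<and> card Y = q - card B}"
    by (simp add: bij_betw_same_card)
  also have "\<dots> = (card L - card B) choose (q - card B)"
    using assms fB by (simp add: n_subsets card_Diff_subset)
  finally show ?thesis .
qed

text \<open>The ratio of the two binomials is the product of the factors
  \<open>(q - i) / (n - i)\<close> for \<open>i < b\<close>, and each of them is at most
  \<open>q / n\<close> because \<open>q \<le> n\<close>.\<close>

lemma binomial_diff_le: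
  assumes "b \<le> q" "q \<le> n"
  shows "real ((n - b) choose (q - b)) \<le> (real q / real n) ^ b * real (n choose q)"
  using assms
proof (induction b)
  case (Suc b)
  let ?N = "n - Suc b" and ?K = "q - Suc b"
  have N: "n - b = Suc ?N" and K: "q - b = Suc ?K" using Suc.prems by auto
  have "real (Suc ?N) * real (?N choose ?K) = real (Suc ?N choose Suc ?K) * real (Suc ?K)"
    by (metis Suc_times_binomial_eq of_nat_mult)
  then have "real (?N choose ?K) = real (Suc ?K) / real (Suc ?N) * real (Suc ?N choose Suc ?K)"
    by (simp add: field_simps del: binomial_Suc_Suc)
  also have "\<dots> \<le> real q / real n * real (Suc ?N choose Suc ?K)"
  proof (rule mult_right_mono)
    have "real (Suc ?K) = real q - real b" "real (Suc ?N) = real n - real b"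
      using Suc.prems by (auto simp: of_nat_diff)
    moreover have "real b * real q \<le> real b * real n"
      using Suc.prems by (intro mult_left_mono) auto
    ultimately show "real (Suc ?K) / real (Suc ?N) \<le> real q / real n"
      using Suc.prems by (simp add: divide_simps algebra_simps)
  qed simp
  also have "\<dots> \<le> real q / real n * ((real q / real n) ^ b * real (n choose q))"
    using Suc by (intro mult_left_mono) (simp_all add: N[symmetric] K[symmetric])
  finally show ?case by (simp add: mult_ac)
qed simp

text \<open>Probabilities are kept as cardinalities, with \<open>card L choose q\<close> as the
  total mass, until the union bound. If \<open>B\<close> has more than \<open>q\<close> points, no
  \<open>X\<close> contains it.\<close>

lemma card_superset_subsets_le:
  assumes "finite L" "B \<subseteq> L" "q \<le> card L"
  shows "real (card {X. X \<subseteq> L \<and> card X = q \<and> B \<subseteq> X})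
           \<le> (real q / real (card L)) ^ card B * real (card L choose q)"
proof (cases "card B \<le> q")
  case True
  then show ?thesis
    using binomial_diff_le[of "card B" q "card L"] assms by (simp add: card_superset_subsets)
next
  case False
  have "{X. X \<subseteq> L \<and> card X = q \<and> B \<subseteq> X} = {}"
    using False assms(1) by (auto dest: finite_subset card_mono)
  then show ?thesis by (simp only:) simp
qed

text \<open>Passing to complements turns avoiding \<open>B\<close> into containing \<open>B\<close>,
  for sets of size \<open>card L - q\<close> and density \<open>1 - q / card L\<close>.\<close>

lemma card_avoiding_subsets_le:
  assumes "finite L" "B \<subseteq> L" "q \<le> card L"
  shows "real (card {X. X \<subseteq> L \<and> card X = q \<and> X \<inter> B = {}})
           \<le> (1 - real q / real (card L)) ^ card B * real (card L choose q)"
\<comment> \<open>Division by zero gives 0, so \<open>(card L - q) / card L = 1 - q / card L\<close>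
  fails for empty \<open>L\<close>.\<close>
proof (cases "card L = 0")
  case True
  then have "B = {}" using assms by auto
  then show ?thesis using assms by (simp add: n_subsets)
next
  case False
  have "bij_betw (\<lambda>X. L - X) {X. X \<subseteq> L \<and> card X = q \<and> X \<inter> B = {}}
          {X. X \<subseteq> L \<and> card X = card L - q \<and> B \<subseteq> X}"
  proof (rule bij_betw_byWitness[where f' = "\<lambda>X. L - X"])
    show "(\<lambda>X. L - X) ` {X. X \<subseteq> L \<and> card X = card L - q \<and> B \<subseteq> X}
        \<subseteq> {X. X \<subseteq> L \<and> card X = q \<and> X \<inter> B = {}}"
      using assms by (auto simp: card_Diff_subset finite_subset)
    show "(\<lambda>X. L - X) ` {X. X \<subseteq> L \<and> card X = q \<and> X \<inter> B = {}}
        \<subseteq> {X. X \<subseteq> L \<and> card X = card L - q \<and> B \<subseteq> X}"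
      using assms by (auto simp: card_Diff_subset finite_subset)
  qed auto
  then have "real (card {X. X \<subseteq> L \<and> card X = q \<and> X \<inter> B = {}})
      = real (card {X. X \<subseteq> L \<and> card X = card L - q \<and> B \<subseteq> X})"
    by (simp add: bij_betw_same_card)
  also have "\<dots> \<le> (real (card L - q) / real (card L)) ^ card B * real (card L choose (card L - q))"
    using assms by (intro card_superset_subsets_le) auto
  also have "real (card L - q) / real (card L) = 1 - real q / real (card L)"
    using False assms by (simp add: of_nat_diff field_simps)
  finally show ?thesis using assms by (simp add: binomial_symmetric[symmetric])
qed

text \<open>
  The factor \<open>x ^ card (X \<inter> D)\<close> is the probability that \<open>X\<close> misses a random subset of \<open>D\<close> that
  takes each point independently with probability \<open>1 - x\<close>; this trades the hypergeometric moment
  for avoidance probabilities.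
\<close>

lemma sum_power_card_Int_le:
  fixes x :: real
  assumes "finite L" "D \<subseteq> L" "q \<le> card L" "0 \<le> x" "x \<le> 1"
  shows "(\<Sum>X | X \<subseteq> L \<and> card X = q. x ^ card (X \<inter> D))
           \<le> (1 - real q / real (card L) * (1 - x)) ^ card D * real (card L choose q)"
proof -
  let ?\<Omega> = "{X. X \<subseteq> L \<and> card X = q}" and ?p = "real q / real (card L)"
  have fD: "finite D" using assms finite_subset by blast
  have f\<Omega>: "finite ?\<Omega>" using assms(1) by (auto intro: finite_subset[of _ "Pow L"])
  have expand: "x ^ card (X \<inter> D)
      = (\<Sum>S\<in>Pow D. (if X \<inter> S = {} then (1 - x) ^ card S else 0) * x ^ card (D - S))" for X
  proof -
    have "x ^ card (X \<inter> D) = (\<Prod>i\<in>D. if i \<in> X then x else 1)"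
      using fD by (simp add: prod.If_cases Int_commute)
    \<comment> \<open>With each factor written as a sum, the product expands over the subsets
      \<open>S\<close> of \<open>D\<close>, and the indicator that \<open>X\<close> avoids
      \<open>S\<close> appears.\<close>
    also have "\<dots> = (\<Prod>i\<in>D. (if i \<in> X then 0 else 1 - x) + x)"
      by (intro prod.cong) auto
    also have "\<dots> = (\<Sum>S\<in>Pow D. (\<Prod>i\<in>S. if i \<in> X then 0 else 1 - x) * (\<Prod>i\<in>D - S. x))"
      using fD by (rule prod_add)
    also have "\<dots> = (\<Sum>S\<in>Pow D. (if X \<inter> S = {} then (1 - x) ^ card S else 0) * x ^ card (D - S))"
    proof (intro sum.cong refl)
      fix S assume "S \<in> Pow D"
      then have fS: "finite S" using fD finite_subset by blast
      have "(\<Prod>i\<in>S. if i \<in> X then 0 else 1 - x) = (if X \<inter> S = {} then (1 - x) ^ card S else 0)"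
      proof (cases "X \<inter> S = {}")
        case True
        then have "(\<Prod>i\<in>S. if i \<in> X then 0 else 1 - x) = (\<Prod>i\<in>S. 1 - x)"
          by (intro prod.cong) auto
        then show ?thesis using True by simp
      next
        case False
        then obtain i where "i \<in> X" "i \<in> S" by auto
        then show ?thesis using False fS by (auto intro!: prod_zero)
      qed
      then show "(\<Prod>i\<in>S. if i \<in> X then 0 else 1 - x) * (\<Prod>i\<in>D - S. x)
          = (if X \<inter> S = {} then (1 - x) ^ card S else 0) * x ^ card (D - S)"
        by simp
    qed
    finally show ?thesis .
  qed
  have "(\<Sum>X\<in>?\<Omega>. x ^ card (X \<inter> D))
      = (\<Sum>S\<in>Pow D. \<Sum>X\<in>?\<Omega>. (if X \<inter> S = {} then (1 - x) ^ card S else 0) * x ^ card (D - S))"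
    unfolding expand by (rule sum.swap)
  also have "\<dots> = (\<Sum>S\<in>Pow D. real (card {X. X \<subseteq> L \<and> card X = q \<and> X \<inter> S = {}})
                 * (1 - x) ^ card S * x ^ card (D - S))"
  proof (intro sum.cong refl)
    fix S
    have "(\<Sum>X\<in>?\<Omega>. (if X \<inter> S = {} then (1 - x) ^ card S else 0) * x ^ card (D - S))
        = (\<Sum>X\<in>?\<Omega>. if X \<inter> S = {} then (1 - x) ^ card S * x ^ card (D - S) else 0)"
      by (intro sum.cong) auto
    also have "\<dots> = (\<Sum>X\<in>{X\<in>?\<Omega>. X \<inter> S = {}}. (1 - x) ^ card S * x ^ card (D - S))"
      using f\<Omega> by (simp only: sum.inter_filter)
    finally show "(\<Sum>X\<in>?\<Omega>. (if X \<inter> S = {} then (1 - x) ^ card S else 0) * x ^ card (D - S))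
        = real (card {X. X \<subseteq> L \<and> card X = q \<and> X \<inter> S = {}}) * (1 - x) ^ card S * x ^ card (D - S)"
      by (simp add: conj_assoc)
  qed
  also have "\<dots> \<le> (\<Sum>S\<in>Pow D. ((1 - ?p) ^ card S * real (card L choose q))
                 * (1 - x) ^ card S * x ^ card (D - S))"
    using assms by (intro sum_mono mult_right_mono card_avoiding_subsets_le) auto
  also have "\<dots> = real (card L choose q)
      * (\<Sum>S\<in>Pow D. (\<Prod>i\<in>S. (1 - ?p) * (1 - x)) * (\<Prod>i\<in>D - S. x))"
    by (simp add: sum_distrib_left power_mult_distrib mult_ac)
  \<comment> \<open>The avoidance bound is a product over \<open>S\<close>, so the same expansion
    can be read backwards.\<close>
  also have "(\<Sum>S\<in>Pow D. (\<Prod>i\<in>S. (1 - ?p) * (1 - x)) * (\<Prod>i\<in>D - S. x))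
      = (\<Prod>i\<in>D. (1 - ?p) * (1 - x) + x)"
    using fD by (rule prod_add[symmetric])
  also have "(1 - ?p) * (1 - x) + x = 1 - ?p * (1 - x)" by (simp add: algebra_simps)
  finally show ?thesis by (simp add: mult.commute)
qed

text \<open>Markov's inequality for \<open>(1/2) ^ card (X \<inter> D)\<close>, with
  \<open>1 - p / 2 \<le> exp (- p / 2)\<close> applied to the moment bound. The base 1/2 suffices
  because \<open>2/3 * ln 2 < 1/2\<close>: the bound decays when \<open>a\<close> is two thirds of
  the mean.\<close>

lemma hypergeometric_lower_tail:
  fixes a :: real
  assumes "finite L" "D \<subseteq> L" "q \<le> card L"
  shows "real (card {X. X \<subseteq> L \<and> card X = q \<and> real (card (X \<inter> D)) < a})
           \<le> exp (ln 2 * a - real q * real (card D) / real (card L) / 2) * real (card L choose q)"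
proof -
  let ?\<Omega> = "{X. X \<subseteq> L \<and> card X = q}" and ?p = "real q / real (card L)"
  have f\<Omega>: "finite ?\<Omega>" using assms(1) by (auto intro: finite_subset[of _ "Pow L"])
  have half: "(1/2 :: real) ^ j = exp (- ln 2 * real j)" for j
    by (simp add: exp_minus exp_of_nat_mult power_divide field_simps)
  have "real (card {X. X \<subseteq> L \<and> card X = q \<and> real (card (X \<inter> D)) < a})
      = (\<Sum>X\<in>?\<Omega>. if real (card (X \<inter> D)) < a then 1 else 0)"
    using f\<Omega> by (simp add: sum.inter_filter[symmetric] conj_assoc)
  also have "\<dots> \<le> (\<Sum>X\<in>?\<Omega>. exp (ln 2 * a) * (1/2) ^ card (X \<inter> D))"
  proof (rule sum_mono)
    fix X
    show "(if real (card (X \<inter> D)) < a then 1 else 0) \<le> exp (ln 2 * a) * (1/2) ^ card (X \<inter> D)"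
      by (auto simp: half exp_add[symmetric])
  qed
  also have "\<dots> = exp (ln 2 * a) * (\<Sum>X\<in>?\<Omega>. (1/2) ^ card (X \<inter> D))"
    by (simp add: sum_distrib_left)
  also have "\<dots> \<le> exp (ln 2 * a) * ((1 - ?p * (1 - 1/2)) ^ card D * real (card L choose q))"
    using assms by (intro mult_left_mono sum_power_card_Int_le) auto
  also have "\<dots> \<le> exp (ln 2 * a) * (exp (- ?p / 2) ^ card D * real (card L choose q))"
  proof -
    have "?p \<le> 1" using assms(3) by (cases "card L = 0") auto
    moreover have "1 - ?p / 2 \<le> exp (- ?p / 2)"
      using exp_ge_add_one_self[of "- ?p / 2"] by simp
    ultimately show ?thesis by (intro mult_left_mono mult_right_mono power_mono) auto
  qed
  also have "\<dots> = exp (ln 2 * a - real q * real (card D) / real (card L) / 2) * real (card L choose q)"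
    by (simp add: exp_of_nat_mult[symmetric] exp_add[symmetric] flip: mult.assoc)
  finally show ?thesis .
qed

text \<open>The event is dominated by the sum of \<open>exp (card \<D> - t)\<close> over all
  disjoint subfamilies whose union lies in \<open>X\<close>. By disjointness, the bound on the
  probability that \<open>X\<close> contains the union is a product over the members. The sum over
  all subfamilies then factorises into \<open>1 + exp 1 * p ^ card A\<close>, and
  \<open>1 + y \<le> exp y\<close> finishes.\<close>

lemma disjoint_family_tail:
  fixes t :: real
  assumes "finite L" "\<B> \<subseteq> Pow L" "q \<le> card L"
  defines "p \<equiv> real q / real (card L)"
  shows "real (card {X. X \<subseteq> L \<and> card X = q \<and>
             (\<exists>\<D>. \<D> \<subseteq> \<B> \<and> disjoint \<D> \<and> \<Union>\<D> \<subseteq> X \<and> t \<le> real (card \<D>))})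
           \<le> exp (exp 1 * (\<Sum>A\<in>\<B>. p ^ card A) - t) * real (card L choose q)"
proof -
  let ?\<Omega> = "{X. X \<subseteq> L \<and> card X = q}"
  let ?F = "{\<D>. \<D> \<subseteq> \<B> \<and> disjoint \<D>}"
  have f\<Omega>: "finite ?\<Omega>" using assms(1) by (auto intro: finite_subset[of _ "Pow L"])
  have f\<B>: "finite \<B>" using assms(1,2) finite_subset by blast
  have fF: "finite ?F" using f\<B> by (auto intro: finite_subset[of _ "Pow \<B>"])
  have p: "0 \<le> p" by (simp add: p_def)
  define w where "w \<D> = exp (real (card \<D>) - t)" for \<D> :: "'a set set"
  have "real (card {X. X \<subseteq> L \<and> card X = q \<and>
             (\<exists>\<D>. \<D> \<subseteq> \<B> \<and> disjoint \<D> \<and> \<Union>\<D> \<subseteq> X \<and> t \<le> real (card \<D>))})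
      = (\<Sum>X\<in>?\<Omega>. if \<exists>\<D>. \<D> \<subseteq> \<B> \<and> disjoint \<D> \<and> \<Union>\<D> \<subseteq> X \<and> t \<le> real (card \<D>) then 1 else 0)"
    using f\<Omega> by (simp add: sum.inter_filter[symmetric] conj_assoc)
  also have "\<dots> \<le> (\<Sum>X\<in>?\<Omega>. \<Sum>\<D>\<in>?F. if \<Union>\<D> \<subseteq> X then w \<D> else 0)"
  proof (rule sum_mono)
    fix X
    have nn: "0 \<le> (\<Sum>\<D>\<in>?F. if \<Union>\<D> \<subseteq> X then w \<D> else 0)"
      by (intro sum_nonneg) (auto simp: w_def)
    show "(if \<exists>\<D>. \<D> \<subseteq> \<B> \<and> disjoint \<D> \<and> \<Union>\<D> \<subseteq> X \<and> t \<le> real (card \<D>) then 1 else 0)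
        \<le> (\<Sum>\<D>\<in>?F. if \<Union>\<D> \<subseteq> X then w \<D> else 0)"
    proof (cases "\<exists>\<D>. \<D> \<subseteq> \<B> \<and> disjoint \<D> \<and> \<Union>\<D> \<subseteq> X \<and> t \<le> real (card \<D>)")
      case True
      then obtain \<D> where D: "\<D> \<in> ?F" "\<Union>\<D> \<subseteq> X" "t \<le> real (card \<D>)" by auto
      have "1 \<le> (if \<Union>\<D> \<subseteq> X then w \<D> else 0)" using D by (simp add: w_def)
      also have "\<dots> \<le> (\<Sum>\<D>\<in>?F. if \<Union>\<D> \<subseteq> X then w \<D> else 0)"
        using D(1) fF by (intro member_le_sum) (auto simp: w_def)
      finally show ?thesis using True by simp
    next
      case False
      then show ?thesis using nn by (simp only: if_False)
    qed
  qed
  also have "\<dots> = (\<Sum>\<D>\<in>?F. \<Sum>X\<in>?\<Omega>. if \<Union>\<D> \<subseteq> X then w \<D> else 0)"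
    by (rule sum.swap)
  also have "\<dots> = (\<Sum>\<D>\<in>?F. w \<D> * real (card {X. X \<subseteq> L \<and> card X = q \<and> \<Union>\<D> \<subseteq> X}))"
    using f\<Omega> by (simp add: sum.inter_filter[symmetric] conj_assoc mult.commute)
  also have "\<dots> \<le> (\<Sum>\<D>\<in>?F. w \<D> * (p ^ card (\<Union>\<D>) * real (card L choose q)))"
    unfolding p_def using assms(1-3)
    by (intro sum_mono mult_left_mono card_superset_subsets_le) (auto simp: w_def)
  also have "\<dots> = (\<Sum>\<D>\<in>?F. exp (- t) * real (card L choose q) * (\<Prod>A\<in>\<D>. exp 1 * p ^ card A))"
  proof (rule sum.cong[OF refl])
    fix \<D> assume D: "\<D> \<in> ?F"
    then have fin: "finite \<D>" "\<And>A. A \<in> \<D> \<Longrightarrow> finite A"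
      using f\<B> assms(1,2) by (auto intro: finite_subset)
    have "card (\<Union>\<D>) = (\<Sum>A\<in>\<D>. card A)"
      using D fin by (intro card_Union_disjoint) auto
    then show "w \<D> * (p ^ card (\<Union>\<D>) * real (card L choose q))
        = exp (- t) * real (card L choose q) * (\<Prod>A\<in>\<D>. exp 1 * p ^ card A)"
      by (simp add: w_def power_sum prod.distrib exp_diff exp_minus exp_of_nat_mult[of _ 1, simplified]
          field_simps)
  qed
  \<comment> \<open>Enlarging the sum to all subfamilies adds only nonnegative terms and makes it a
    product.\<close>
  also have "\<dots> \<le> (\<Sum>\<D>\<in>Pow \<B>. exp (- t) * real (card L choose q) * (\<Prod>A\<in>\<D>. exp 1 * p ^ card A))"
    using f\<B> p by (intro sum_mono2) (auto intro!: mult_nonneg_nonneg prod_nonneg)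
  also have "\<dots> = exp (- t) * real (card L choose q) * (\<Prod>A\<in>\<B>. exp 1 * p ^ card A + 1)"
    by (simp add: sum_distrib_left prod_add[OF f\<B>])
  also have "\<dots> \<le> exp (- t) * real (card L choose q) * exp (\<Sum>A\<in>\<B>. exp 1 * p ^ card A)"
    using p prod_le_exp_sum[of \<B> "\<lambda>A. exp 1 * p ^ card A"]
    by (intro mult_left_mono) (simp_all add: add.commute)
  also have "\<dots> = exp (exp 1 * (\<Sum>A\<in>\<B>. p ^ card A) - t) * real (card L choose q)"
    by (simp add: sum_distrib_left exp_diff exp_minus field_simps)
  finally show ?thesis .
qed

section \<open>Degrees and common neighbours\<close>

definition left_nbhd :: "'v bigraph \<Rightarrow> 'v \<Rightarrow> 'v set" where
  "left_nbhd G v = {u \<in> lverts G. {u, v} \<in> edges G}"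

lemma bipartite_edge_cases:
  assumes "bipartite_graph G" "{x, y} \<in> edges G"
  shows "x \<in> lverts G \<and> y \<in> rverts G \<or> x \<in> rverts G \<and> y \<in> lverts G"
proof -
  obtain u v where "{x, y} = {u, v}" "u \<in> lverts G" "v \<in> rverts G"
    using assms unfolding bipartite_graph_def by blast
  then show ?thesis by (auto simp: doubleton_eq_iff)
qed

lemma bipartite_edge_left:
  "bipartite_graph G \<Longrightarrow> {x, y} \<in> edges G \<Longrightarrow> x \<in> lverts G \<Longrightarrow> y \<in> rverts G"
  using bipartite_edge_cases[of G x y] by (auto simp: bipartite_graph_def)

lemma bipartite_edge_right:
  "bipartite_graph G \<Longrightarrow> {x, y} \<in> edges G \<Longrightarrow> x \<in> rverts G \<Longrightarrow> y \<in> lverts G"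
  using bipartite_edge_cases[of G x y] by (auto simp: bipartite_graph_def)

lemma vdegree_right:
  assumes "bipartite_graph G" "v \<in> rverts G"
  shows "vdegree G v = card (left_nbhd G v)"
proof -
  have "{e \<in> edges G. v \<in> e} = (\<lambda>u. {u, v}) ` left_nbhd G v"
  proof (intro equalityI subsetI)
    fix e assume e: "e \<in> {e \<in> edges G. v \<in> e}"
    then obtain a b where ab: "e = {a, b}" "a \<in> lverts G" "b \<in> rverts G"
      using assms unfolding bipartite_graph_def by blast
    moreover have "v = b" using e ab assms by (auto simp: bipartite_graph_def)
    ultimately show "e \<in> (\<lambda>u. {u, v}) ` left_nbhd G v"
      using e by (auto simp: left_nbhd_def)
  qed (auto simp: left_nbhd_def)
  moreover have "inj_on (\<lambda>u. {u, v}) (left_nbhd G v)"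
    by (auto simp: inj_on_def doubleton_eq_iff)
  ultimately show ?thesis by (simp add: vdegree_def card_image)
qed

lemma vdegree_left:
  assumes "bipartite_graph G" "u \<in> lverts G"
  shows "vdegree G u = card (nbhd G {u})"
proof -
  have "{e \<in> edges G. u \<in> e} = (\<lambda>v. {u, v}) ` nbhd G {u}"
  proof (intro equalityI subsetI)
    fix e assume e: "e \<in> {e \<in> edges G. u \<in> e}"
    then obtain a b where ab: "e = {a, b}" "a \<in> lverts G" "b \<in> rverts G"
      using assms unfolding bipartite_graph_def by blast
    moreover have "u = a" using e ab assms by (auto simp: bipartite_graph_def)
    ultimately show "e \<in> (\<lambda>v. {u, v}) ` nbhd G {u}"
      using e by (auto simp: nbhd_def)
  qed (auto simp: nbhd_def)
  moreover have "inj_on (\<lambda>v. {u, v}) (nbhd G {u})"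
    by (auto simp: inj_on_def doubleton_eq_iff)
  ultimately show ?thesis by (simp add: vdegree_def card_image)
qed

lemma biregular_double_count:
  assumes "bipartite_graph G" "left_regular G d" "right_regular G \<delta>"
  shows "card (lverts G) * d = card (rverts G) * \<delta>"
proof -
  have "(\<Sum>u\<in>lverts G. card {v \<in> rverts G. {u, v} \<in> edges G}) = \<delta> * card (rverts G)"
  proof (rule sum_multicount)
    show "\<forall>v\<in>rverts G. card {u \<in> lverts G. {u, v} \<in> edges G} = \<delta>"
      using assms by (auto simp: right_regular_def vdegree_right left_nbhd_def)
  qed (use assms in \<open>auto simp: bipartite_graph_def\<close>)
  moreover have "card {v \<in> rverts G. {u, v} \<in> edges G} = d" if "u \<in> lverts G" for u
    using assms that by (auto simp: left_regular_def vdegree_left nbhd_def)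
  ultimately show ?thesis by (simp add: mult.commute)
qed

text \<open>Expansion at \<open>t = 2\<close> gives \<open>{x, y}\<close> at least
  \<open>2 * (d - 1/2) = 2 * d - 1\<close> neighbours, while the two degrees add up to
  \<open>2 * d\<close>. Inclusion-exclusion leaves at most one common neighbour.\<close>

lemma optimal_expander_common_nbr_unique:
  assumes G: "optimal_expander d 2 G" and xy: "x \<in> lverts G" "y \<in> lverts G" "x \<noteq> y"
    and a: "{x, a} \<in> edges G" "{y, a} \<in> edges G"
    and b: "{x, b} \<in> edges G" "{y, b} \<in> edges G"
  shows "a = b"
proof (rule ccontr)
  assume "a \<noteq> b"
  have bip: "bipartite_graph G" and lreg: "left_regular G d"
    using G by (auto simp: optimal_expander_def)
  have fin: "finite (lverts G)" "finite (rverts G)" using bip by (auto simp: bipartite_graph_def)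
  have "real d - 1 + 1 / 2 \<le> expansion G 2"
    using G unfolding optimal_expander_def by (elim conjE allE[where x = 2]) simp
  also have "\<dots> \<le> real (card (nbhd G {x, y})) / real (card {x, y})"
    unfolding expansion_def using xy fin
    by (intro Min_le finite_imageI imageI) (auto intro: finite_subset[of _ "Pow (lverts G)"])
  finally have *: "2 * real d - 1 \<le> real (card (nbhd G {x, y}))" using xy by simp
  have fN: "finite (nbhd G Y)" for Y using fin by (simp add: nbhd_def)
  have "nbhd G {x, y} = nbhd G {x} \<union> nbhd G {y}" by (auto simp: nbhd_def)
  then have "card (nbhd G {x, y}) + card (nbhd G {x} \<inter> nbhd G {y}) = 2 * d"
    using card_Un_Int[OF fN fN, of "{x}" "{y}"] bip lreg xy
    by (simp add: left_regular_def vdegree_left)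
  moreover have "card {a, b} \<le> card (nbhd G {x} \<inter> nbhd G {y})"
    using a b xy bip by (intro card_mono finite_Int disjI1 fN)
      (auto simp: nbhd_def dest: bipartite_edge_left)
  ultimately show False using * \<open>a \<noteq> b\<close> by simp
qed

section \<open>Short cycles and their removal\<close>

text \<open>Only the left vertices of a cycle matter for its deletion, so cycles with the same left
  vertices are identified.\<close>

definition cycle_lefts :: "'v bigraph \<Rightarrow> nat \<Rightarrow> 'v set set" where
  "cycle_lefts G s = {set vs \<inter> lverts G | vs. is_cycle G vs \<and> length vs \<le> 2 * s}"

text \<open>
  If \<open>w\<close> lists the right vertices of a cycle of a 2-optimal expander, starting and ending next to
  \<open>u\<close>, then the remaining left vertices are the common neighbours of consecutive entries of \<open>w\<close>.
\<close>

definition walk_lefts :: "'v bigraph \<Rightarrow> 'v \<Rightarrow> 'v list \<Rightarrow> 'v set" where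
  "walk_lefts G u w = insert u {x \<in> lverts G.
     \<exists>i. Suc i < length w \<and> {x, w ! i} \<in> edges G \<and> {x, w ! Suc i} \<in> edges G}"

definition anchored_lists :: "'v set \<Rightarrow> 'v set \<Rightarrow> nat \<Rightarrow> 'v list set" where
  "anchored_lists R N l = {w. length w = l \<and> set w \<subseteq> R \<and> hd w \<in> N \<and> last w \<in> N}"

lemma is_cycle_rotate:
  assumes "is_cycle G vs"
  shows "is_cycle G (rotate j vs)"
proof -
  have "{rotate j vs ! i, rotate j vs ! (Suc i mod length vs)} \<in> edges G" if "i < length vs" for i
  proof -
    have "Suc i mod length vs < length vs" using that by (intro mod_less_divisor) auto
    then have "rotate j vs ! (Suc i mod length vs) = vs ! (Suc ((j + i) mod length vs) mod length vs)"
      by (simp add: nth_rotate mod_simps)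
    moreover have "rotate j vs ! i = vs ! ((j + i) mod length vs)"
      using that by (simp add: nth_rotate)
    moreover have "(j + i) mod length vs < length vs" using that by (intro mod_less_divisor) auto
    ultimately show ?thesis using assms unfolding is_cycle_def by auto
  qed
  then show ?thesis using assms unfolding is_cycle_def by simp
qed

text \<open>Started at \<open>u\<close>, the cycle has its left vertices at even positions and its
  right vertices at odd ones. The latter form a list \<open>w\<close> that begins and ends next to
  \<open>u\<close>, and every other left vertex is recovered as the unique common neighbour of two
  consecutive entries of \<open>w\<close>.\<close>

lemma cycle_lefts_eq_walk_lefts:
  assumes G: "optimal_expander d 2 G" and A: "A \<in> cycle_lefts G s" and u: "u \<in> A"
  shows "card A \<in> {2..s} \<and> A \<in> walk_lefts G u ` anchored_lists (rverts G) (nbhd G {u}) (card A)"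
proof -
  have bip: "bipartite_graph G" using G by (simp add: optimal_expander_def)
  have disj: "lverts G \<inter> rverts G = {}" using bip by (simp add: bipartite_graph_def)
  obtain vs0 where vs0: "is_cycle G vs0" "length vs0 \<le> 2 * s" "A = set vs0 \<inter> lverts G"
    using A by (auto simp: cycle_lefts_def)
  obtain j where j: "j < length vs0" "vs0 ! j = u" using u vs0 by (auto simp: in_set_conv_nth)
  define vs where "vs = rotate j vs0"
  have cyc: "is_cycle G vs" using vs0 is_cycle_rotate vs_def by blast
  have len: "length vs \<le> 2 * s" "3 \<le> length vs" and dist: "distinct vs"
    using vs0 cyc by (auto simp: vs_def is_cycle_def)
  have Avs: "A = set vs \<inter> lverts G" using vs0 by (simp add: vs_def)
  have "0 < length vs0" using j by auto
  then have vs_0: "vs ! 0 = u" using j nth_rotate[of 0 vs0 j] by (simp add: vs_def)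
  have uL: "u \<in> lverts G" using u Avs by auto
  have edge: "{vs ! i, vs ! Suc i} \<in> edges G" if "Suc i < length vs" for i
    using cyc that unfolding is_cycle_def by (metis Suc_lessD mod_less)
  have last_edge: "{vs ! (length vs - 1), vs ! 0} \<in> edges G"
  proof -
    have "length vs - 1 < length vs" "Suc (length vs - 1) = length vs" using len by linarith+
    then show ?thesis using cyc unfolding is_cycle_def by (metis mod_self)
  qed
  have par: "(even i \<longrightarrow> vs ! i \<in> lverts G) \<and> (odd i \<longrightarrow> vs ! i \<in> rverts G)"
    if "i < length vs" for i
    using that
  proof (induction i)
    case 0
    then show ?case using vs_0 uL by simp
  next
    case (Suc i)
    then show ?case
      using edge[of i] bipartite_edge_left[OF bip] bipartite_edge_right[OF bip] by auto
  qed
  \<comment> \<open>The closing edge leads back to \<open>u\<close>, so the last vertex is a right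
    vertex and the length is even.\<close>
  have "vs ! (length vs - 1) \<in> rverts G"
    using last_edge uL vs_0 bipartite_edge_left[OF bip, of u] by (simp add: insert_commute)
  then have "vs ! (length vs - 1) \<notin> lverts G" using disj by blast
  moreover have "length vs - 1 < length vs" using len by linarith
  ultimately have "odd (length vs - 1)" using par by blast
  then obtain l where l: "length vs = 2 * l" using len by (auto elim!: evenE)
  then have l2: "2 \<le> l" "l \<le> s" using len by auto
  have A_eq: "A = (\<lambda>i. vs ! (2 * i)) ` {..<l}"
  proof (intro equalityI subsetI)
    fix x assume "x \<in> A"
    then obtain i where i: "i < length vs" "x = vs ! i" "x \<in> lverts G"
      using Avs by (auto simp: in_set_conv_nth)
    then have "even i" using par[of i] disj by auto
    then show "x \<in> (\<lambda>i. vs ! (2 * i)) ` {..<l}" using i l by (auto elim!: evenE)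
  next
    fix x assume "x \<in> (\<lambda>i. vs ! (2 * i)) ` {..<l}"
    then obtain i where "i < l" "x = vs ! (2 * i)" by auto
    then show "x \<in> A" using par[of "2 * i"] l Avs by auto
  qed
  have cardA: "card A = l"
  proof -
    have "inj_on (\<lambda>i. vs ! (2 * i)) {..<l}"
      using dist l by (auto simp: inj_on_def nth_eq_iff_index_eq)
    then show ?thesis unfolding A_eq by (simp add: card_image)
  qed
  define w where "w = map (\<lambda>i. vs ! (2 * i + 1)) [0..<l]"
  have lw: "length w = l" and nw: "\<And>i. i < l \<Longrightarrow> w ! i = vs ! (2 * i + 1)"
    by (auto simp: w_def)
  have "w \<noteq> []" using lw l2 by auto
  have "w \<in> anchored_lists (rverts G) (nbhd G {u}) l"
  proof -
    have "set w \<subseteq> rverts G"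
    proof
      fix x assume "x \<in> set w"
      then obtain i where "i < l" "x = vs ! (2 * i + 1)" by (auto simp: w_def)
      then show "x \<in> rverts G" using par[of "2 * i + 1"] l by auto
    qed
    moreover have "hd w = vs ! 1" using \<open>w \<noteq> []\<close> nw[of 0] l2 by (simp add: hd_conv_nth)
    moreover have "last w = vs ! (length vs - 1)"
    proof -
      have "2 * (l - 1) + 1 = length vs - 1" using l l2 by auto
      then show ?thesis using \<open>w \<noteq> []\<close> nw[of "l - 1"] l2 lw by (simp add: last_conv_nth)
    qed
    moreover have "vs ! 1 \<in> nbhd G {u}"
      using edge[of 0] par[of 1] len vs_0 by (auto simp: nbhd_def)
    moreover have "vs ! (length vs - 1) \<in> nbhd G {u}"
      using last_edge vs_0 \<open>vs ! (length vs - 1) \<in> rverts G\<close>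
      by (auto simp: nbhd_def insert_commute)
    ultimately show ?thesis using lw by (simp add: anchored_lists_def)
  qed
  moreover have "A = walk_lefts G u w"
  proof (intro equalityI subsetI)
    fix x assume "x \<in> A"
    then obtain i where i: "i < l" "x = vs ! (2 * i)" using A_eq by auto
    show "x \<in> walk_lefts G u w"
    proof (cases i)
      case 0
      then show ?thesis using i vs_0 by (simp add: walk_lefts_def)
    next
      case (Suc k)
      have "{vs ! (2 * k + 1), vs ! (2 * k + 2)} \<in> edges G" using edge[of "2 * k + 1"] Suc i l by simp
      moreover have "{vs ! (2 * k + 2), vs ! (2 * k + 3)} \<in> edges G"
        using edge[of "2 * k + 2"] Suc i l by (simp add: numeral_3_eq_3)
      ultimately have "{x, w ! k} \<in> edges G \<and> {x, w ! Suc k} \<in> edges G"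
        using i Suc nw[of k] nw[of "Suc k"] by (simp add: insert_commute numeral_3_eq_3)
      moreover have "x \<in> lverts G" using \<open>x \<in> A\<close> Avs by auto
      ultimately show ?thesis using i Suc lw by (auto simp: walk_lefts_def)
    qed
  next
    fix x assume "x \<in> walk_lefts G u w"
    then consider "x = u" | i where "x \<in> lverts G" "Suc i < l"
        "{x, w ! i} \<in> edges G" "{x, w ! Suc i} \<in> edges G"
      using lw by (auto simp: walk_lefts_def)
    then show "x \<in> A"
    proof cases
      case 2
      \<comment> \<open>\<open>y\<close> is the vertex of the cycle between \<open>w ! i\<close> and
        \<open>w ! Suc i\<close>; uniqueness of common neighbours identifies \<open>x\<close> with
        it.\<close>
      define y where "y = vs ! (2 * i + 2)"
      have y: "y \<in> A" unfolding A_eq y_def using 2 by (intro image_eqI[of _ _ "Suc i"]) auto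
      have "{y, w ! i} \<in> edges G"
        using edge[of "2 * i + 1"] 2 l nw[of i] by (simp add: y_def insert_commute)
      moreover have "{y, w ! Suc i} \<in> edges G"
        using edge[of "2 * i + 2"] 2 l nw[of "Suc i"] by (simp add: y_def)
      moreover have "w ! i \<noteq> w ! Suc i"
        using 2 l nw[of i] nw[of "Suc i"] dist by (auto simp: nth_eq_iff_index_eq)
      ultimately have "x = y"
        using optimal_expander_common_nbr_unique[OF G 2(1), of y "w ! i" "w ! Suc i"] 2 y Avs
        by blast
      then show ?thesis using y by simp
    qed (use u in simp)
  qed
  ultimately show ?thesis using cardA l2 by auto
qed

text \<open>Since \<open>2 \<le> l\<close>, the first and last positions are distinct: two entries
  range over \<open>N\<close> and the other \<open>l - 2\<close> over \<open>R\<close>.\<close>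

lemma card_anchored_lists_le:
  assumes "finite R" "finite N" "2 \<le> l"
  shows "finite (anchored_lists R N l)"
    and "card (anchored_lists R N l) \<le> card N ^ 2 * card R ^ (l - 2)"
proof -
  let ?Y = "{ys. set ys \<subseteq> R \<and> length ys = l - 2}"
  have sub: "anchored_lists R N l \<subseteq> (\<lambda>(a, ys, b). a # ys @ [b]) ` (N \<times> ?Y \<times> N)"
  proof
    fix w assume w: "w \<in> anchored_lists R N l"
    then obtain a w' where a: "w = a # w'" "w' \<noteq> []"
      using assms(3) by (cases w; cases "tl w") (auto simp: anchored_lists_def)
    then obtain ys b where b: "w' = ys @ [b]" by (meson rev_exhaust)
    show "w \<in> (\<lambda>(a, ys, b). a # ys @ [b]) ` (N \<times> ?Y \<times> N)"
      using w a b by (auto simp: anchored_lists_def intro!: image_eqI[of _ _ "(a, ys, b)"])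
  qed
  have fY: "finite (N \<times> ?Y \<times> N)" using assms by (auto intro: finite_lists_length_eq)
  then show "finite (anchored_lists R N l)" using sub finite_surj by blast
  have "card (anchored_lists R N l) \<le> card (N \<times> ?Y \<times> N)" using sub fY surj_card_le by blast
  also have "\<dots> = card N ^ 2 * card R ^ (l - 2)"
    using assms by (simp add: card_cartesian_product card_lists_length_eq power2_eq_square)
  finally show "card (anchored_lists R N l) \<le> card N ^ 2 * card R ^ (l - 2)" .
qed

text \<open>These are the cycles whose deletion can lower the degree of \<open>v\<close>.\<close>

definition cycle_lefts_at :: "'v bigraph \<Rightarrow> nat \<Rightarrow> 'v \<Rightarrow> 'v set set" where
  "cycle_lefts_at G s v = {A \<in> cycle_lefts G s. A \<inter> left_nbhd G v \<noteq> {}}"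

text \<open>The left side bounds the expected number of these sets inside the random set. A set of
  size \<open>l\<close> is determined by a member \<open>u\<close> adjacent to \<open>v\<close>, for
  which there are \<open>\<delta>\<close> choices, and an anchored list of length \<open>l\<close>,
  for which there are at most \<open>d ^ 2 * card (rverts G) ^ (l - 2)\<close>.\<close>

lemma sum_power_card_cycle_lefts_at_le:
  fixes p :: real
  assumes G: "optimal_expander d 2 G" "right_regular G \<delta>" and v: "v \<in> rverts G" and p: "0 \<le> p"
  shows "(\<Sum>A\<in>cycle_lefts_at G s v. p ^ card A)
           \<le> (\<Sum>l=2..s. real \<delta> * real d ^ 2 * real (card (rverts G)) ^ (l - 2) * p ^ l)"
proof -
  let ?B = "cycle_lefts_at G s v"
  have bip: "bipartite_graph G" and lreg: "left_regular G d"
    using G by (auto simp: optimal_expander_def)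
  have fin: "finite (lverts G)" "finite (rverts G)" using bip by (auto simp: bipartite_graph_def)
  have sub: "?B \<subseteq> Pow (lverts G)" by (auto simp: cycle_lefts_at_def cycle_lefts_def)
  then have fB: "finite ?B" using fin finite_subset by blast
  have fN: "finite (left_nbhd G v)" using fin by (simp add: left_nbhd_def)
  have mem: "\<exists>u\<in>left_nbhd G v. card A \<in> {2..s} \<and>
      A \<in> walk_lefts G u ` anchored_lists (rverts G) (nbhd G {u}) (card A)" if "A \<in> ?B" for A
    using that cycle_lefts_eq_walk_lefts[OF G(1), of A s] unfolding cycle_lefts_at_def by blast
  have "(\<Sum>A\<in>?B. p ^ card A) = (\<Sum>l=2..s. \<Sum>A\<in>{A\<in>?B. card A = l}. p ^ card A)"
    using mem fB by (intro sum.group[symmetric]) auto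
  also have "\<dots> = (\<Sum>l=2..s. real (card {A\<in>?B. card A = l}) * p ^ l)"
    by (intro sum.cong) auto
  also have "\<dots> \<le> (\<Sum>l=2..s. real (\<delta> * (d ^ 2 * card (rverts G) ^ (l - 2))) * p ^ l)"
  proof (intro sum_mono mult_right_mono)
    fix l assume l: "l \<in> {2..s}"
    let ?U = "\<lambda>u. walk_lefts G u ` anchored_lists (rverts G) (nbhd G {u}) l"
    have fn: "finite (nbhd G {u})" for u using fin by (simp add: nbhd_def)
    have fU: "finite (?U u)" for u
      using card_anchored_lists_le(1)[OF fin(2) fn] l by auto
    have "{A\<in>?B. card A = l} \<subseteq> (\<Union>u\<in>left_nbhd G v. ?U u)" using mem by blast
    then have "card {A\<in>?B. card A = l} \<le> card (\<Union>u\<in>left_nbhd G v. ?U u)"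
      using fN fU by (intro card_mono) auto
    also have "\<dots> \<le> (\<Sum>u\<in>left_nbhd G v. card (?U u))" using fN by (rule card_UN_le)
    also have "\<dots> \<le> (\<Sum>u\<in>left_nbhd G v. d ^ 2 * card (rverts G) ^ (l - 2))"
    proof (rule sum_mono)
      fix u assume "u \<in> left_nbhd G v"
      then have "card (nbhd G {u}) = d"
        using bip lreg by (simp add: left_nbhd_def left_regular_def vdegree_left)
      moreover have "card (?U u) \<le> card (anchored_lists (rverts G) (nbhd G {u}) l)"
        using card_anchored_lists_le(1)[OF fin(2) fn] l by (intro card_image_le) auto
      ultimately show "card (?U u) \<le> d ^ 2 * card (rverts G) ^ (l - 2)"
        using card_anchored_lists_le(2)[OF fin(2) fn, of l u] l by auto
    qed
    also have "\<dots> = \<delta> * (d ^ 2 * card (rverts G) ^ (l - 2))"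
      using G v bip by (simp add: right_regular_def vdegree_right)
    finally show "real (card {A\<in>?B. card A = l}) \<le> real (\<delta> * (d ^ 2 * card (rverts G) ^ (l - 2)))"
      by (rule of_nat_mono)
  qed (use p in simp)
  finally show ?thesis by (simp add: mult_ac)
qed

text \<open>Induction on the steps: a cycle of the current graph is a cycle of \<open>G\<close>, and
  it uses only surviving left vertices, so its left part is disjoint from everything deleted
  before.\<close>

lemma removal_steps_delete_disjoint_cycles:
  assumes bip: "bipartite_graph G" and X: "X \<subseteq> lverts G"
    and steps: "(removal_step s)\<^sup>*\<^sup>* (induced G X) T"
  shows "\<exists>\<C>. \<C> \<subseteq> cycle_lefts G s \<and> disjoint \<C> \<and> \<Union>\<C> \<subseteq> X \<and>
           T = delete_left (induced G X) (\<Union>\<C>)"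
  using steps
proof (induction rule: rtranclp_induct)
  case base
  show ?case by (intro exI[of _ "{}"]) (auto simp: delete_left_def induced_def)
next
  case (step T T')
  then obtain \<C> where C: "\<C> \<subseteq> cycle_lefts G s" "disjoint \<C>" "\<Union>\<C> \<subseteq> X"
    and T: "T = delete_left (induced G X) (\<Union>\<C>)" by auto
  obtain vs where vs: "is_cycle T vs" "length vs \<le> 2 * s"
    and T': "T' = delete_left T (set vs \<inter> lverts T)"
    using step by (auto simp: removal_step_def)
  have eT: "edges T \<subseteq> edges G" by (auto simp: T delete_left_def induced_def)
  have lT: "lverts T = X - \<Union>\<C>" by (simp add: T delete_left_def induced_def)
  \<comment> \<open>Each vertex of the cycle lies on an edge of \<open>T\<close>, so its left
    vertices have not been deleted. Hence taking left vertices in \<open>T\<close> or in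
    \<open>G\<close> gives the same set.\<close>
  have "set vs \<inter> lverts G \<subseteq> lverts T"
  proof
    fix x assume x: "x \<in> set vs \<inter> lverts G"
    then obtain i where i: "i < length vs" "x = vs ! i" by (auto simp: in_set_conv_nth)
    then have "{x, vs ! (Suc i mod length vs)} \<in> edges T" using vs by (simp add: is_cycle_def)
    moreover have "x \<notin> nbhd G X" using x bip by (auto simp: nbhd_def bipartite_graph_def)
    ultimately show "x \<in> lverts T" by (auto simp: T delete_left_def induced_def)
  qed
  then have A: "set vs \<inter> lverts T = set vs \<inter> lverts G" using lT X by auto
  have "is_cycle G vs" using vs(1) eT by (auto simp: is_cycle_def)
  then have "set vs \<inter> lverts T \<in> cycle_lefts G s" using vs(2) A by (auto simp: cycle_lefts_def)
  moreover have "disjoint (insert (set vs \<inter> lverts T) \<C>)"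
    using C(2) lT by (auto simp: disjoint_def)
  moreover have "T' = delete_left (induced G X) (\<Union>(insert (set vs \<inter> lverts T) \<C>))"
    unfolding T' by (auto simp: T delete_left_def induced_def)
  ultimately show ?case using C lT by (intro exI[of _ "insert (set vs \<inter> lverts T) \<C>"]) auto
qed

lemma vdegree_delete_induced:
  assumes "bipartite_graph G" "X \<subseteq> lverts G" "S \<subseteq> lverts G" "v \<in> nbhd G X"
  shows "vdegree (delete_left (induced G X) S) v = card (X \<inter> left_nbhd G v - S)"
proof -
  let ?T = "delete_left (induced G X) S"
  have v: "v \<in> rverts G" "v \<notin> S" using assms by (auto simp: nbhd_def bipartite_graph_def)
  have bip: "bipartite_graph ?T"
    unfolding bipartite_graph_def
  proof (intro conjI)
    show "edges ?T \<subseteq> {{u, v} |u v. u \<in> lverts ?T \<and> v \<in> rverts ?T}"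
    proof
      fix e assume e: "e \<in> edges ?T"
      then obtain a b where ab: "e = {a, b}" "a \<in> lverts G" "b \<in> rverts G"
        using assms(1) by (auto simp: bipartite_graph_def delete_left_def induced_def)
      then have "a \<in> X - S" "b \<in> nbhd G X"
        using e assms by (auto simp: bipartite_graph_def delete_left_def induced_def nbhd_def)
      then show "e \<in> {{u, v} |u v. u \<in> lverts ?T \<and> v \<in> rverts ?T}"
        using ab by (auto simp: delete_left_def induced_def)
    qed
  qed (use assms in \<open>auto simp: delete_left_def induced_def nbhd_def bipartite_graph_def
        intro: finite_subset\<close>)
  have "X \<inter> left_nbhd G v - S = left_nbhd ?T v"
    using v assms(2,4) by (auto simp: left_nbhd_def delete_left_def induced_def)
  moreover have "v \<in> rverts ?T" using assms(4) by (simp add: delete_left_def induced_def)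
  ultimately show ?thesis using vdegree_right[OF bip] by simp
qed

text \<open>A deterministic statement. Let \<open>v\<close> attain the minimum. Each deleted cycle
  that meets its neighbourhood costs it at most \<open>s\<close> neighbours, so with fewer than
  \<open>t\<close> such cycles its degree before the removal was already below
  \<open>a\<close>.\<close>

lemma small_min_right_degree_cases:
  fixes a t :: real
  assumes G: "optimal_expander d 2 G" and d: "d > 0" and X: "X \<subseteq> lverts G" "X \<noteq> {}"
    and T: "removal_result s (induced G X) T"
    and small: "real (min_right_degree T) < a - real s * t"
  shows "\<exists>v\<in>rverts G. real (card (X \<inter> left_nbhd G v)) < a \<or>
           (\<exists>\<D>. \<D> \<subseteq> cycle_lefts_at G s v \<and> disjoint \<D> \<and> \<Union>\<D> \<subseteq> X \<and> t \<le> real (card \<D>))"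
proof -
  have bip: "bipartite_graph G" and lreg: "left_regular G d"
    using G by (auto simp: optimal_expander_def)
  have fin: "finite (lverts G)" "finite (rverts G)" using bip by (auto simp: bipartite_graph_def)
  obtain \<C> where C: "\<C> \<subseteq> cycle_lefts G s" "disjoint \<C>" "\<Union>\<C> \<subseteq> X"
    and TC: "T = delete_left (induced G X) (\<Union>\<C>)"
    using removal_steps_delete_disjoint_cycles[OF bip X(1)] T unfolding removal_result_def by blast
  obtain u where u: "u \<in> X" using X by auto
  \<comment> \<open>The graph must have a right vertex, as otherwise \<open>Min\<close> would be
    taken over the empty set.\<close>
  have "card (nbhd G {u}) > 0"
    using d u X(1) bip lreg by (auto simp: left_regular_def vdegree_left)
  then obtain v0 where "v0 \<in> nbhd G {u}" by (metis card_gt_0_iff ex_in_conv)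
  then have "nbhd G X \<noteq> {}" using u by (auto simp: nbhd_def)
  moreover have "finite (nbhd G X)" using fin by (simp add: nbhd_def)
  moreover have rT: "rverts T = nbhd G X" by (simp add: TC delete_left_def induced_def)
  ultimately have "min_right_degree T \<in> vdegree T ` nbhd G X"
    unfolding min_right_degree_def rT by (intro Min_in) auto
  then obtain v where v: "v \<in> nbhd G X" "min_right_degree T = vdegree T v" by auto
  let ?N = "X \<inter> left_nbhd G v"
  define \<D> where "\<D> = {A \<in> \<C>. A \<inter> left_nbhd G v \<noteq> {}}"
  have fX: "finite X" using X fin finite_subset by blast
  have D: "\<D> \<subseteq> cycle_lefts_at G s v" "disjoint \<D>" "\<Union>\<D> \<subseteq> X"
    using C by (auto simp: \<D>_def cycle_lefts_at_def disjoint_def)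
  have fD: "finite \<D>" using D(3) fX by (auto intro: finite_subset[of _ "Pow X"])
  \<comment> \<open>Members of \<open>\<D>\<close> meet the neighbourhood of \<open>v\<close>, so
    they have an element at which the cycle can be started.\<close>
  have cA: "card A \<le> s" if A: "A \<in> \<D>" for A
  proof -
    obtain x where "x \<in> A" using A unfolding \<D>_def by blast
    then show ?thesis
      using cycle_lefts_eq_walk_lefts[OF G, of A s x] A C(1) by (auto simp: \<D>_def)
  qed
  have "card (?N \<inter> \<Union>\<C>) \<le> card (\<Union>\<D>)"
    using D(3) fX by (intro card_mono) (auto simp: \<D>_def intro: finite_subset)
  also have "\<dots> \<le> (\<Sum>A\<in>\<D>. card A)" using card_UN_le[OF fD, of id] by simp
  also have "\<dots> \<le> card \<D> * s" using cA sum_bounded_above[of \<D> card s] by simp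
  finally have removed: "card (?N \<inter> \<Union>\<C>) \<le> card \<D> * s" .
  have "card ?N = card (?N \<inter> \<Union>\<C>) + card (?N - \<Union>\<C>)"
    using fX by (simp add: card_Int_Diff)
  moreover have "card (?N - \<Union>\<C>) = vdegree T v"
    using vdegree_delete_induced[OF bip X(1) _ v(1), of "\<Union>\<C>"] C(3) X(1) TC by auto
  ultimately have "real (card ?N) \<le> real (card \<D>) * real s + real (min_right_degree T)"
    using removed v(2) by (simp flip: of_nat_mult of_nat_add)
  moreover have "real (card \<D>) * real s \<le> t * real s" if "\<not> t \<le> real (card \<D>)"
    using that by (intro mult_right_mono) auto
  ultimately have "real (card ?N) < a \<or> t \<le> real (card \<D>)"
    using small by (cases "t \<le> real (card \<D>)") (auto simp: mult.commute)
  moreover have "v \<in> rverts G" using v by (simp add: nbhd_def)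
  ultimately show ?thesis using D by blast
qed

text \<open>Union bound over the right vertices, with one tail estimate for each of the two ways in
  which a vertex can end up with small degree.\<close>

lemma prob_small_min_right_degree_le:
  fixes a t :: real
  assumes G: "optimal_expander d 2 G" "right_regular G \<delta>" and d: "d > 0"
    and q: "0 < q" "q \<le> card (lverts G)"
    and T: "\<And>X. X \<in> left_subsets G q \<Longrightarrow> removal_result s (induced G X) (T X)"
  defines "p \<equiv> real q / real (card (lverts G))" and "m \<equiv> real (card (rverts G))"
  shows "measure_pmf.prob (pmf_of_set (left_subsets G q))
           {X. real (min_right_degree (T X)) < a - real s * t}
         \<le> m * (exp (ln 2 * a - p * real \<delta> / 2) +
               exp (exp 1 * (\<Sum>l=2..s. real \<delta> * real d ^ 2 * m ^ (l - 2) * p ^ l) - t))"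
proof -
  let ?L = "lverts G" and ?\<Omega> = "left_subsets G q"
  let ?bound = "exp (ln 2 * a - p * real \<delta> / 2) +
      exp (exp 1 * (\<Sum>l=2..s. real \<delta> * real d ^ 2 * m ^ (l - 2) * p ^ l) - t)"
  define E1 where "E1 v = {X. X \<subseteq> ?L \<and> card X = q \<and> real (card (X \<inter> left_nbhd G v)) < a}" for v
  define E2 where "E2 v = {X. X \<subseteq> ?L \<and> card X = q \<and> (\<exists>\<D>. \<D> \<subseteq> cycle_lefts_at G s v \<and>
      disjoint \<D> \<and> \<Union>\<D> \<subseteq> X \<and> t \<le> real (card \<D>))}" for v
  have bip: "bipartite_graph G" using G by (auto simp: optimal_expander_def)
  have fin: "finite ?L" "finite (rverts G)" using bip by (auto simp: bipartite_graph_def)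
  have fE: "finite (E1 v)" "finite (E2 v)" for v
    using fin by (auto simp: E1_def E2_def intro: finite_subset[of _ "Pow ?L"])
  have c\<Omega>: "card ?\<Omega> = card ?L choose q" using fin by (simp add: left_subsets_def n_subsets)
  then have pos: "card ?\<Omega> > 0" using q by simp
  then have \<Omega>: "?\<Omega> \<noteq> {}" "finite ?\<Omega>" by (auto simp: card_gt_0_iff)
  have "?\<Omega> \<inter> {X. real (min_right_degree (T X)) < a - real s * t}
      \<subseteq> (\<Union>v\<in>rverts G. E1 v \<union> E2 v)"
  proof
    fix X assume X: "X \<in> ?\<Omega> \<inter> {X. real (min_right_degree (T X)) < a - real s * t}"
    then have "X \<subseteq> ?L" "card X = q" "X \<noteq> {}" using q by (auto simp: left_subsets_def)
    then show "X \<in> (\<Union>v\<in>rverts G. E1 v \<union> E2 v)"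
      using small_min_right_degree_cases[OF G(1) d _ _ T, of X a t] X
      unfolding E1_def E2_def by blast
  qed
  then have "card (?\<Omega> \<inter> {X. real (min_right_degree (T X)) < a - real s * t})
      \<le> card (\<Union>v\<in>rverts G. E1 v \<union> E2 v)"
    using fin fE by (intro card_mono) auto
  also have "\<dots> \<le> (\<Sum>v\<in>rverts G. card (E1 v \<union> E2 v))" using fin by (intro card_UN_le)
  also have "\<dots> \<le> (\<Sum>v\<in>rverts G. card (E1 v) + card (E2 v))"
    by (intro sum_mono card_Un_le)
  finally have "real (card (?\<Omega> \<inter> {X. real (min_right_degree (T X)) < a - real s * t}))
      \<le> (\<Sum>v\<in>rverts G. real (card (E1 v)) + real (card (E2 v)))"
    by (simp flip: of_nat_add of_nat_sum)
  also have "\<dots> \<le> (\<Sum>v\<in>rverts G. ?bound * real (card ?\<Omega>))"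
  proof (rule sum_mono)
    fix v assume v: "v \<in> rverts G"
    have "card (left_nbhd G v) = \<delta>" using G v bip by (simp add: right_regular_def vdegree_right)
    then have 1: "real (card (E1 v)) \<le> exp (ln 2 * a - p * real \<delta> / 2) * real (card ?\<Omega>)"
      using hypergeometric_lower_tail[OF fin(1) _ q(2), of "left_nbhd G v" a]
      by (simp add: E1_def p_def c\<Omega> left_nbhd_def)
    have "real (card (E2 v))
        \<le> exp (exp 1 * (\<Sum>A\<in>cycle_lefts_at G s v. p ^ card A) - t) * real (card ?\<Omega>)"
      unfolding E2_def p_def c\<Omega>
      by (rule disjoint_family_tail[OF fin(1) _ q(2)]) (auto simp: cycle_lefts_at_def cycle_lefts_def)
    also have "\<dots> \<le> exp (exp 1 * (\<Sum>l=2..s. real \<delta> * real d ^ 2 * m ^ (l - 2) * p ^ l) - t)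
        * real (card ?\<Omega>)"
      using sum_power_card_cycle_lefts_at_le[OF G v, of p s]
      by (simp add: mult_right_mono p_def m_def)
    finally show "real (card (E1 v)) + real (card (E2 v)) \<le> ?bound * real (card ?\<Omega>)"
      using 1 by (simp add: distrib_right)
  qed
  also have "\<dots> = m * ?bound * real (card ?\<Omega>)" by (simp add: m_def)
  finally show ?thesis
    using \<Omega> pos by (simp add: measure_pmf_of_set divide_le_eq)
qed

section \<open>Asymptotics\<close>

text \<open>The decay of the tails absorbs the factor \<open>m\<close> of the union bound.\<close>

lemma times_exp_neg_powr_tendsto_0:
  fixes \<kappa> b :: real
  assumes "\<kappa> > 0" "b > 0"
  shows "((\<lambda>x. x * exp (- \<kappa> * x powr b)) \<longlongrightarrow> 0) at_top"
  using assms by real_asymp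

theorem theorem4p6:
  fixes d s :: nat and c \<beta> :: real
    and G :: "nat \<Rightarrow> 'v bigraph" and \<delta> n m q :: "nat \<Rightarrow> nat"
    and T :: "nat \<Rightarrow> 'v set \<Rightarrow> 'v bigraph"
  assumes "d > 0" and "s \<ge> 3" and "c > 0"
    and "1 < \<beta>" and "\<beta> < 1 + 1 / (real s - 1)"
    and n_def: "\<And>k. n k = card (lverts (G k))"
    and m_def: "\<And>k. m k = card (rverts (G k))"
    and q_def: "\<And>k. q k = nat \<lfloor>c * real (m k) powr \<beta>\<rfloor>"
    and expander: "\<And>k. optimal_expander d 2 (G k)"
    and right_reg: "\<And>k. right_regular (G k) (\<delta> k)"
    and m_lim: "filterlim m at_top sequentially"
    and n_order: "\<exists>c1 c2. 0 < c1 \<and> c1 \<le> c2 \<and>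
           (\<forall>\<^sub>F k in sequentially.
              c1 * real (m k) ^ 2 \<le> real (n k) \<and> real (n k) \<le> c2 * real (m k) ^ 2)"
    and q_less: "\<And>k. q k < n k"
    and T_result: "\<And>k X. X \<in> left_subsets (G k) (q k) \<Longrightarrow>
           removal_result s (induced (G k) X) (T k X)"
  shows "(\<lambda>k. measure_pmf.prob (pmf_of_set (left_subsets (G k) (q k)))
            {X. real (min_right_degree (T k X))
                  < 1 / 2 * real d * c * real (m k) powr (\<beta> - 1)})
         \<longlonglongrightarrow> 0"
proof -
  obtain c1 c2 where c12: "0 < c1" "c1 \<le> c2" and n_bounds: "\<forall>\<^sub>F k in sequentially.
      c1 * real (m k) ^ 2 \<le> real (n k) \<and> real (n k) \<le> c2 * real (m k) ^ 2"
    using n_order by blast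
  define M where "M x = real d * c * x powr (\<beta> - 1)" for x :: real
  \<comment> \<open>Chosen so that \<open>2/3 * M - s * t = 1/2 * M\<close>, the threshold of the
    theorem.\<close>
  define t where "t x = M x / (6 * real s)" for x
  \<comment> \<open>This is the bound on the expected number of short cycles near \<open>v\<close>
    after inserting \<open>\<delta> \<le> c2 * d * x\<close> and
    \<open>p \<le> c / c1 * x powr (\<beta> - 2)\<close>; the exponent is
    \<open>1 + (l - 2) + l * (\<beta> - 2)\<close>.\<close>
  define \<mu> where "\<mu> x = (\<Sum>l=2..s. c2 * real d ^ 3 * (c / c1) ^ l * x powr (real l * (\<beta> - 1) - 1))"
    for x :: real
  \<comment> \<open>Positive because \<open>ln 2 \<le> 25/36 < 3/4\<close>.\<close>
  define \<kappa> where "\<kappa> = (1 / 2 - 2 / 3 * ln 2) * real d * c"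
  \<comment> \<open>Half the coefficient of \<open>t\<close>: the other half of \<open>t\<close>
    pays for the exponential moment of the cycle count.\<close>
  define \<theta> where "\<theta> = real d * c / (12 * real s)"
  define B where "B x = exp (real d / 2) * (x * exp (- \<kappa> * x powr (\<beta> - 1)))
      + x * exp (- \<theta> * x powr (\<beta> - 1))" for x :: real
  have \<beta>: "\<beta> - 1 > 0" using assms by simp
  have s: "real s > 0" using \<open>s \<ge> 3\<close> by simp
  have \<kappa>: "\<kappa> > 0" unfolding \<kappa>_def using ln2_le_25_over_36 \<open>d > 0\<close> \<open>c > 0\<close> by simp
  have \<theta>: "\<theta> > 0" unfolding \<theta>_def using s \<open>d > 0\<close> \<open>c > 0\<close> by simp
  have "(B \<longlongrightarrow> exp (real d / 2) * 0 + 0) at_top"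
    unfolding B_def using \<kappa> \<theta> \<beta> by (intro tendsto_intros times_exp_neg_powr_tendsto_0)
  then have B_lim: "(B \<longlongrightarrow> 0) at_top" by simp
  \<comment> \<open>This is \<open>exp 1 * \<mu>\<close> divided by
    \<open>x powr (\<beta> - 1)\<close>, the order of \<open>M\<close>. All its exponents are
    negative exactly because \<open>(s - 1) * (\<beta> - 1) < 1\<close>, which is the upper bound on
    \<open>\<beta>\<close>.\<close>
  have "((\<lambda>x. \<Sum>l=2..s. exp 1 * c2 * real d ^ 3 * (c / c1) ^ l * x powr (real (l - 1) * (\<beta> - 1) - 1))
      \<longlongrightarrow> 0) at_top"
  proof (intro tendsto_null_sum tendsto_mult_right_zero tendsto_neg_powr filterlim_ident)
    fix l assume l: "l \<in> {2..s}"
    have "real (l - 1) * (\<beta> - 1) \<le> (real s - 1) * (\<beta> - 1)"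
      using l \<beta> by (intro mult_right_mono) auto
    also have "\<dots> < 1" using assms(2,5) by (simp add: field_simps)
    finally show "real (l - 1) * (\<beta> - 1) - 1 < 0" by simp
  qed
  then have "\<forall>\<^sub>F x in at_top. (\<Sum>l=2..s. exp 1 * c2 * real d ^ 3 * (c / c1) ^ l *
      x powr (real (l - 1) * (\<beta> - 1) - 1)) < \<theta>"
    using \<theta> by (rule order_tendstoD)
  then have \<mu>_small: "\<forall>\<^sub>F x in at_top. exp 1 * \<mu> x \<le> t x / 2"
  proof (rule eventually_mono)
    fix x :: real
    assume less: "(\<Sum>l=2..s. exp 1 * c2 * real d ^ 3 * (c / c1) ^ l *
      x powr (real (l - 1) * (\<beta> - 1) - 1)) < \<theta>"
    have "exp 1 * \<mu> x = (\<Sum>l=2..s. exp 1 * c2 * real d ^ 3 * (c / c1) ^ l *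
      x powr (real (l - 1) * (\<beta> - 1) - 1)) * x powr (\<beta> - 1)"
      unfolding \<mu>_def sum_distrib_left sum_distrib_right
    proof (rule sum.cong[OF refl])
      fix l assume l: "l \<in> {2..s}"
      have "real l * (\<beta> - 1) - 1 = (real (l - 1) * (\<beta> - 1) - 1) + (\<beta> - 1)"
        using l by (simp add: of_nat_diff algebra_simps)
      then have "x powr (real l * (\<beta> - 1) - 1)
          = x powr (real (l - 1) * (\<beta> - 1) - 1) * x powr (\<beta> - 1)"
        by (simp only: powr_add)
      then show "exp 1 * (c2 * real d ^ 3 * (c / c1) ^ l * x powr (real l * (\<beta> - 1) - 1))
        = exp 1 * c2 * real d ^ 3 * (c / c1) ^ l * x powr (real (l - 1) * (\<beta> - 1) - 1)
          * x powr (\<beta> - 1)"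
        by simp
    qed
    also have "\<dots> \<le> \<theta> * x powr (\<beta> - 1)" using less by (intro mult_right_mono) auto
    also have "\<dots> = t x / 2" by (simp add: \<theta>_def t_def M_def)
    finally show "exp 1 * \<mu> x \<le> t x / 2" .
  qed
  have rm_lim: "filterlim (\<lambda>k. real (m k)) at_top sequentially"
    using m_lim filterlim_compose filterlim_real_sequentially by blast
  \<comment> \<open>This makes \<open>q k\<close> positive, so that the random set is
    nonempty.\<close>
  have "\<forall>\<^sub>F x in at_top. 1 \<le> c * x powr \<beta>"
    using \<open>c > 0\<close> assms(4) by real_asymp
  then have "\<forall>\<^sub>F x in at_top. 1 \<le> x \<and> 1 \<le> c * x powr \<beta> \<and> exp 1 * \<mu> x \<le> t x / 2"
    using \<mu>_small eventually_ge_at_top[of 1] by eventually_elim auto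
  then have ev: "\<forall>\<^sub>F k in sequentially. 1 \<le> real (m k) \<and> 1 \<le> c * real (m k) powr \<beta> \<and>
      exp 1 * \<mu> (real (m k)) \<le> t (real (m k)) / 2"
    using rm_lim by (rule eventually_compose_filterlim)
  have "\<forall>\<^sub>F k in sequentially. measure_pmf.prob (pmf_of_set (left_subsets (G k) (q k)))
      {X. real (min_right_degree (T k X)) < 1 / 2 * real d * c * real (m k) powr (\<beta> - 1)}
      \<le> B (real (m k))"
    using ev n_bounds
  proof eventually_elim
    case (elim k)
    define x where "x = real (m k)"
    define p where "p = real (q k) / real (n k)"
    have x: "1 \<le> x" "1 \<le> c * x powr \<beta>" "exp 1 * \<mu> x \<le> t x / 2"
      and n: "c1 * x ^ 2 \<le> real (n k)" "real (n k) \<le> c2 * x ^ 2"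
      using elim by (auto simp: x_def)
    have q_le: "real (q k) \<le> c * x powr \<beta>" and q_ge: "c * x powr \<beta> - 1 \<le> real (q k)"
      using x(2) unfolding q_def x_def by (simp_all add: of_nat_nat)
    have q_pos: "0 < q k" using x(2) unfolding q_def x_def by simp
    have npos: "0 < real (n k)" using q_less[of k] by simp
    have "real (n k * d) = real (m k * \<delta> k)"
      using biregular_double_count[of "G k" d "\<delta> k"] expander[of k] right_reg[of k]
      by (simp add: optimal_expander_def n_def m_def)
    then have \<delta>: "real (\<delta> k) = real (n k) * real d / x"
      using x(1) by (simp add: x_def field_simps)
    have "real (n k) * real d / x \<le> c2 * x ^ 2 * real d / x"
      using n x(1) by (intro divide_right_mono mult_right_mono) auto
    then have \<delta>_le: "real (\<delta> k) \<le> c2 * real d * x"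
      using \<delta> x(1) by (simp add: power2_eq_square mult_ac)
    have xb: "x powr \<beta> = x powr (\<beta> - 1) * x" using x(1) by (simp add: powr_diff)
    \<comment> \<open>By double counting, \<open>p * \<delta> = q * d / m\<close>, so rounding
      \<open>q\<close> down lowers the mean degree by at most \<open>d / m \<le> d\<close>.\<close>
    have "M x - real d \<le> M x - real d / x"
      using x(1) mult_right_mono[OF x(1), of "real d"] by (simp add: field_simps)
    also have "\<dots> = (c * x powr \<beta> - 1) * real d / x"
      using x(1) by (simp add: M_def xb field_simps)
    also have "\<dots> \<le> real (q k) * real d / x"
      using q_ge x(1) by (intro divide_right_mono mult_right_mono) auto
    also have "\<dots> = p * real (\<delta> k)" using npos by (simp add: p_def \<delta>)
    finally have mean: "M x - real d \<le> p * real (\<delta> k)" .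
    have "p \<le> c * x powr \<beta> / (c1 * x ^ 2)"
      unfolding p_def using q_le n x(1) c12 by (intro frac_le) auto
    also have "\<dots> = c / c1 * x powr (\<beta> - 2)"
      using x(1) by (simp add: powr_diff powr_numeral)
    finally have p_le: "p \<le> c / c1 * x powr (\<beta> - 2)" .
    have p0: "0 \<le> p" by (simp add: p_def)
    have "(\<Sum>l=2..s. real (\<delta> k) * real d ^ 2 * x ^ (l - 2) * p ^ l) \<le> \<mu> x"
      unfolding \<mu>_def
    proof (rule sum_mono)
      fix l assume l: "l \<in> {2..s}"
      have "real (\<delta> k) * real d ^ 2 * x ^ (l - 2) * p ^ l
          \<le> (c2 * real d * x) * real d ^ 2 * x ^ (l - 2) * (c / c1 * x powr (\<beta> - 2)) ^ l"
        using \<delta>_le p_le p0 x(1) c12 by (intro mult_mono power_mono mult_nonneg_nonneg) auto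
      also have "(c / c1 * x powr (\<beta> - 2)) ^ l = (c / c1) ^ l * x powr ((\<beta> - 2) * real l)"
        using x(1) by (simp only: power_mult_distrib powr_power) (simp add: powr_power mult.commute)
      also have "c2 * real d * x * real d ^ 2 * x ^ (l - 2) * ((c / c1) ^ l * x powr ((\<beta> - 2) * real l))
          = c2 * real d ^ 3 * (c / c1) ^ l * (x powr 1 * x powr (real l - 2) * x powr ((\<beta> - 2) * real l))"
        using x(1) l by (simp add: powr_realpow[symmetric] of_nat_diff
            power2_eq_square power3_eq_cube)
      also have "x powr 1 * x powr (real l - 2) * x powr ((\<beta> - 2) * real l)
          = x powr (real l * (\<beta> - 1) - 1)"
        by (simp only: powr_add[symmetric]) (simp add: algebra_simps)
      finally show "real (\<delta> k) * real d ^ 2 * x ^ (l - 2) * p ^ l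
          \<le> c2 * real d ^ 3 * (c / c1) ^ l * x powr (real l * (\<beta> - 1) - 1)" .
    qed
    then have "exp 1 * (\<Sum>l=2..s. real (\<delta> k) * real d ^ 2 * x ^ (l - 2) * p ^ l) \<le> exp 1 * \<mu> x"
      by (intro mult_left_mono) auto
    moreover have "t x = 2 * (\<theta> * x powr (\<beta> - 1))" by (simp add: \<theta>_def t_def M_def)
    ultimately have e2: "exp 1 * (\<Sum>l=2..s. real (\<delta> k) * real d ^ 2 * x ^ (l - 2) * p ^ l) - t x
        \<le> - \<theta> * x powr (\<beta> - 1)"
      using x(3) by linarith
    \<comment> \<open>The term \<open>d / 2\<close> is the cost of rounding \<open>q\<close>; it
      becomes the constant factor \<open>exp (d / 2)\<close> in \<open>B\<close>.\<close>
    have e1: "ln 2 * (2 / 3 * M x) - p * real (\<delta> k) / 2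
        \<le> real d / 2 + - \<kappa> * x powr (\<beta> - 1)"
      using mean by (simp add: \<kappa>_def M_def algebra_simps)
    have threshold: "1 / 2 * real d * c * real (m k) powr (\<beta> - 1) = 2 / 3 * M x - real s * t x"
      using s by (simp add: t_def M_def x_def)
    have "q k \<le> card (lverts (G k))" using q_less[of k] by (simp add: n_def)
    then have "measure_pmf.prob (pmf_of_set (left_subsets (G k) (q k)))
        {X. real (min_right_degree (T k X)) < 1 / 2 * real d * c * real (m k) powr (\<beta> - 1)}
        \<le> x * (exp (ln 2 * (2 / 3 * M x) - p * real (\<delta> k) / 2) +
            exp (exp 1 * (\<Sum>l=2..s. real (\<delta> k) * real d ^ 2 * x ^ (l - 2) * p ^ l) - t x))"
      unfolding threshold unfolding x_def p_def n_def m_def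
      by (rule prob_small_min_right_degree_le[OF expander right_reg \<open>d > 0\<close> q_pos _ T_result])
    also have "\<dots> \<le> x * (exp (real d / 2 + - \<kappa> * x powr (\<beta> - 1)) + exp (- \<theta> * x powr (\<beta> - 1)))"
      using e1 e2 x(1) by (intro mult_left_mono add_mono) auto
    also have "\<dots> = B x" unfolding B_def exp_add by (simp add: distrib_left)
    finally show ?case unfolding x_def .
  qed
  moreover have "(\<lambda>k. B (real (m k))) \<longlonglongrightarrow> 0"
    using filterlim_compose[OF B_lim rm_lim] .
  ultimately show ?thesis
    by (rule tendsto_sandwich[OF always_eventually[OF allI[OF measure_nonneg]] _ tendsto_const])
qed

end
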